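(* The Gaussian and mean curvatures of an admissible helicoidal surface of i-type in $\mathbb{I}^3$, $$Z_2(u,t)=(x(u)\cos(t\phi),\ x(u)\sin(t\phi),\ z(u)+ct),$$ with $C^2$ generating curve $\alpha(u)=(x(u),0,z(u))$, are respectively $$K=-\frac{z'(x''z'-x'z'')}{x\,x'^4}-\frac{c^2}{\phi^2x^4}\qquad\text{and}\qquad H=\frac{x'^2z'-x(x''z'-x'z'')}{2x\,x'^3}.$$
   Context: Here $c,\phi\in\mathbb{R}$ are constants, and primes denote $d/du$. The simply isotropic space $\mathbb{I}^3$ is $\mathbb{R}^3$ with the degenerate metric $\langle u,v\rangle_z=u^1v^1+u^2v^2$. For a $C^2$ parameterized surface $\mathbf{x}(u^1,u^2)=(x^1,x^2,x^3)$ write $\mathbf{x}_i=\partial\mathbf{x}/\partial u^i$, $\mathbf{x}_{ij}=\partial^2\mathbf{x}/\partial u^i\partial u^j$, $x^i_k=\partial x^i/\partial u^k$, $X_{ij}=x^i_1x^j_2-x^j_1x^i_2$. The surface is admissible if $X_{12}\neq0$ (equivalently, the induced metric has rank 2). Put $g_{ij}=\langle\mathbf{x}_i,\mathbf{x}_j\rangle_z$, $N_h=\left(\frac{X_{23}}{X_{12}},\frac{X_{31}}{X_{12}},1\right)$, $h_{ij}=\langle N_h,\mathbf{x}_{ij}\rangle$ (Euclidean inner product). The Gaussian and mean curvatures are $$K=\frac{h_{11}h_{22}-h_{12}^2}{g_{11}g_{22}-g_{12}^2},\qquad H=\frac12\,\frac{g_{11}h_{22}-2g_{12}h_{12}+g_{22}h_{11}}{g_{11}g_{22}-g_{12}^2};$$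 equivalently $K=\det L$, $H=\frac12\mathrm{tr}\,L$ with $L=-D\xi$, $\xi=\left(A,B,\frac12(1-A^2-B^2)\right)$, $A=X_{23}/X_{12}$, $B=X_{31}/X_{12}$. For the surface in the claim the coordinates are $(u^1,u^2)=(u,t)$. *)

theory Defs
  imports "HOL-Analysis.Analysis"
begin

definition C2_differentiable_on ::
    "(real \<Rightarrow> 'a::real_normed_vector) \<Rightarrow> real set \<Rightarrow> bool" where
  "C2_differentiable_on f I \<longleftrightarrow>
     f C1_differentiable_on I \<and> (\<lambda>u. vector_derivative f (at u)) C1_differentiable_on I"

text \<open>A parameterized surface is a map \<open>S :: real^2 \<Rightarrow> real^3\<close>, of which only the
  restriction to an open parameter domain matters; \<open>p $ 1\<close> and \<open>p $ 2\<close> are the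
  surface coordinates.\<close>

definition pd :: "2 \<Rightarrow> (real^2 \<Rightarrow> real^3) \<Rightarrow> real^2 \<Rightarrow> real^3" where
  "pd i S p = vector_derivative (\<lambda>s. S (p + s *\<^sub>R axis i 1)) (at 0)"

definition iso_metric :: "real^3 \<Rightarrow> real^3 \<Rightarrow> real" where
  "iso_metric v w = v $ 1 * w $ 1 + v $ 2 * w $ 2"

definition minor_X :: "(real^2 \<Rightarrow> real^3) \<Rightarrow> 3 \<Rightarrow> 3 \<Rightarrow> real^2 \<Rightarrow> real" where
  "minor_X S i j p = pd 1 S p $ i * pd 2 S p $ j - pd 1 S p $ j * pd 2 S p $ i"

definition admissible_on :: "(real^2 \<Rightarrow> real^3) \<Rightarrow> (real^2) set \<Rightarrow> bool" where
  "admissible_on S U \<longleftrightarrow> (\<forall>p\<in>U. minor_X S 1 2 p \<noteq> 0)"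

definition first_form :: "(real^2 \<Rightarrow> real^3) \<Rightarrow> 2 \<Rightarrow> 2 \<Rightarrow> real^2 \<Rightarrow> real" where
  "first_form S i j p = iso_metric (pd i S p) (pd j S p)"

definition normal_h :: "(real^2 \<Rightarrow> real^3) \<Rightarrow> real^2 \<Rightarrow> real^3" where
  "normal_h S p =
     vector [minor_X S 2 3 p / minor_X S 1 2 p, minor_X S 3 1 p / minor_X S 1 2 p, 1]"

definition second_form :: "(real^2 \<Rightarrow> real^3) \<Rightarrow> 2 \<Rightarrow> 2 \<Rightarrow> real^2 \<Rightarrow> real" where
  "second_form S i j p = normal_h S p \<bullet> pd i (pd j S) p"

definition gauss_curvature :: "(real^2 \<Rightarrow> real^3) \<Rightarrow> real^2 \<Rightarrow> real" where
  "gauss_curvature S p =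
     (second_form S 1 1 p * second_form S 2 2 p - (second_form S 1 2 p)\<^sup>2)
     / (first_form S 1 1 p * first_form S 2 2 p - (first_form S 1 2 p)\<^sup>2)"

definition mean_curvature :: "(real^2 \<Rightarrow> real^3) \<Rightarrow> real^2 \<Rightarrow> real" where
  "mean_curvature S p =
     1 / 2 * ((first_form S 1 1 p * second_form S 2 2 p
               - 2 * first_form S 1 2 p * second_form S 1 2 p
               + first_form S 2 2 p * second_form S 1 1 p)
              / (first_form S 1 1 p * first_form S 2 2 p - (first_form S 1 2 p)\<^sup>2))"

definition generating_curve :: "(real \<Rightarrow> real) \<Rightarrow> (real \<Rightarrow> real) \<Rightarrow> real \<Rightarrow> real^3" where
  "generating_curve x z u = vector [x u, 0, z u]"

text \<open>The orbit of the generating curve under the helicoidal motion of i-type, with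
  parameters \<open>(p $ 1, p $ 2) = (u, t)\<close>.\<close>

definition helicoidal_i ::
    "real \<Rightarrow> real \<Rightarrow> (real \<Rightarrow> real) \<Rightarrow> (real \<Rightarrow> real) \<Rightarrow> real^2 \<Rightarrow> real^3" where
  "helicoidal_i c \<phi> x z p =
     vector [x (p $ 1) * cos (p $ 2 * \<phi>), x (p $ 1) * sin (p $ 2 * \<phi>), z (p $ 1) + c * p $ 2]"

end

theory Submission
  imports Defs
begin

text \<open>The Gaussian and mean curvatures are rational functions of the first and second
  partial derivatives of the surface, so the formulas come out of a direct computation.
  It is short because the helicoidal motion carries along the rotated frame
  \<open>e = (cos (t\<phi>), sin (t\<phi>), 0)\<close>, \<open>e' = (- sin (t\<phi>), cos (t\<phi>), 0)\<close>: in this frame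
  \<open>\<partial>\<^sub>u = x' e + z' k\<close> and \<open>\<partial>\<^sub>t = \<phi> x e' + c k\<close> with \<open>k = (0, 0, 1)\<close> the isotropic direction.  Hence
  the first form is diagonal with entries \<open>x'\<^sup>2\<close> and \<open>(\<phi> x)\<^sup>2\<close>, and the normal is
  \<open>- (z' / x') e - (c / (\<phi> x)) e' + k\<close>, which pairs with the second derivatives to give
  \<open>h\<^sub>1\<^sub>1 = (x' z'' - x'' z') / x'\<close>, \<open>h\<^sub>1\<^sub>2 = - c x' / x\<close> and \<open>h\<^sub>2\<^sub>2 = \<phi>\<^sup>2 x z' / x'\<close>.  All
  angular dependence disappears through \<open>sin\<^sup>2 + cos\<^sup>2 = 1\<close>.

  Admissibility means \<open>\<phi> x x' \<noteq> 0\<close>, which is exactly what makes the divisions legitimate.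
  The only analytic point is that a second partial derivative needs the first one on a whole
  coordinate segment around the point; for \<open>\<partial>\<^sub>u\<^sub>u\<close> such a segment exists because \<open>I\<close> is open.\<close>

lemma has_vector_derivative_componentwise_vec:
  fixes f :: "real \<Rightarrow> real^'n"
  shows "(f has_vector_derivative v) (at s within S) \<longleftrightarrow>
         (\<forall>i. ((\<lambda>s. f s $ i) has_real_derivative v $ i) (at s within S))"
  unfolding has_vector_derivative_def has_field_derivative_def
  by (subst has_derivative_componentwise_within)
     (simp add: Basis_vec_def inner_axis mult.commute[of _ "v $ _"] mult_commute_abs)

lemma has_vector_derivative_vector3:
  assumes "(f has_real_derivative f') (at s)" "(g has_real_derivative g') (at s)"
    and "(h has_real_derivative h') (at s)"
  shows "((\<lambda>s. vector [f s, g s, h s] :: real^3) has_vector_derivative vector [f', g', h']) (at s)"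
  using assms by (simp add: has_vector_derivative_componentwise_vec forall_3)

text \<open>On the open set \<open>I\<close> the derivative of the curve agrees componentwise with \<open>deriv x\<close>
  and \<open>deriv z\<close>, and differentiability depends only on germs, so the second differentiability
  of the curve passes to \<open>deriv x\<close> and \<open>deriv z\<close>.\<close>

lemma C2_generating_curve_imp_derivatives:
  assumes "open I" "C2_differentiable_on (generating_curve x z) I" "u \<in> I"
  shows "(x has_real_derivative deriv x u) (at u)"
    and "(z has_real_derivative deriv z u) (at u)"
    and "(deriv x has_real_derivative deriv (deriv x) u) (at u)"
    and "(deriv z has_real_derivative deriv (deriv z) u) (at u)"
proof -
  let ?\<alpha> = "generating_curve x z"
  let ?\<alpha>' = "\<lambda>u. vector_derivative ?\<alpha> (at u)"
  have first: "(x has_real_derivative ?\<alpha>' v $ 1) (at v)"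
      "(z has_real_derivative ?\<alpha>' v $ 3) (at v)" if "v \<in> I" for v
  proof -
    have "(?\<alpha> has_vector_derivative ?\<alpha>' v) (at v)"
      using assms(2) that
      by (auto simp: C2_differentiable_on_def C1_differentiable_on_def vector_derivative_at)
    then have "((\<lambda>s. ?\<alpha> s $ i) has_real_derivative ?\<alpha>' v $ i) (at v)" for i
      by (simp add: has_vector_derivative_componentwise_vec)
    from this[of 1] this[of 3]
    show "(x has_real_derivative ?\<alpha>' v $ 1) (at v)" "(z has_real_derivative ?\<alpha>' v $ 3) (at v)"
      by (simp_all add: generating_curve_def)
  qed
  then have deriv_eq: "deriv x v = ?\<alpha>' v $ 1" "deriv z v = ?\<alpha>' v $ 3" if "v \<in> I" for v
    using that by (auto intro: DERIV_imp_deriv)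
  show "(x has_real_derivative deriv x u) (at u)" "(z has_real_derivative deriv z u) (at u)"
    using first assms(3) by (simp_all add: deriv_eq)
  obtain D where "(?\<alpha>' has_vector_derivative D) (at u)"
    using assms(2,3) by (auto simp: C2_differentiable_on_def C1_differentiable_on_def)
  then have D: "((\<lambda>v. ?\<alpha>' v $ i) has_real_derivative D $ i) (at u)" for i
    by (simp add: has_vector_derivative_componentwise_vec)
  have "(deriv x has_real_derivative D $ 1) (at u)" "(deriv z has_real_derivative D $ 3) (at u)"
    by (rule has_field_derivative_transform_within_open[OF D assms(1,3)], simp add: deriv_eq)+
  then show "(deriv x has_real_derivative deriv (deriv x) u) (at u)"
    "(deriv z has_real_derivative deriv (deriv z) u) (at u)"
    by (auto simp: DERIV_imp_deriv)
qed

text \<open>Partial derivatives are those of the restrictions to the two coordinate lines.  The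
  first variable may be confined to an open set, since only germs matter; this lets a formula
  for a first partial derivative that is known over \<open>I\<close> alone be differentiated again.\<close>

lemma pd_1_eqI:
  fixes S :: "real^2 \<Rightarrow> real^3"
  assumes "open I" "u \<in> I"
    and "\<And>v. v \<in> I \<Longrightarrow> S (vector [v, t]) = vector [f v, g v, h v]"
    and "(f has_real_derivative f') (at u)" "(g has_real_derivative g') (at u)"
    and "(h has_real_derivative h') (at u)"
  shows "pd 1 S (vector [u, t]) = vector [f', g', h']"
proof -
  have line: "vector [u, t] + s *\<^sub>R axis 1 1 = (vector [s + u, t] :: real^2)" for s
    by (simp add: vec_eq_iff forall_2 axis_def)
  have "((\<lambda>v. S (vector [v, t])) has_vector_derivative vector [f', g', h']) (at u)"
    by (rule has_vector_derivative_transform_within_open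
          [OF has_vector_derivative_vector3[OF assms(4-6)] assms(1,2)])
       (simp add: assms(3))
  then have "((\<lambda>s. S (vector [s + u, t])) has_vector_derivative vector [f', g', h']) (at 0)"
    using vector_diff_chain_at[of "\<lambda>s. s + u" 1 0 "\<lambda>v. S (vector [v, t])"]
      has_vector_derivative_add_const[of "\<lambda>s. s" u 1 "at 0"]
    by (simp add: o_def)
  then show ?thesis
    by (simp add: pd_def line vector_derivative_at)
qed

lemma pd_2_eqI:
  fixes S :: "real^2 \<Rightarrow> real^3"
  assumes "\<And>r. S (vector [u, r]) = vector [f r, g r, h r]"
    and "(f has_real_derivative f') (at t)" "(g has_real_derivative g') (at t)"
    and "(h has_real_derivative h') (at t)"
  shows "pd 2 S (vector [u, t]) = vector [f', g', h']"
proof -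
  have line: "vector [u, t] + s *\<^sub>R axis 2 1 = (vector [u, s + t] :: real^2)" for s
    by (simp add: vec_eq_iff forall_2 axis_def)
  have "((\<lambda>r. S (vector [u, r])) has_vector_derivative vector [f', g', h']) (at t)"
    using has_vector_derivative_vector3[OF assms(2-4)] by (simp add: assms(1))
  then have "((\<lambda>s. S (vector [u, s + t])) has_vector_derivative vector [f', g', h']) (at 0)"
    using vector_diff_chain_at[of "\<lambda>s. s + t" 1 0 "\<lambda>r. S (vector [u, r])"]
      has_vector_derivative_add_const[of "\<lambda>s. s" t 1 "at 0"]
    by (simp add: o_def)
  then show ?thesis
    by (simp add: pd_def line vector_derivative_at)
qed

lemma helicoidal_i_vector:
  "helicoidal_i c \<phi> x z (vector [u, t]) =
     vector [x u * cos (t * \<phi>), x u * sin (t * \<phi>), z u + c * t]"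
  by (simp add: helicoidal_i_def)

lemma pd_1_helicoidal_i:
  assumes "(x has_real_derivative x') (at u)" "(z has_real_derivative z') (at u)"
  shows "pd 1 (helicoidal_i c \<phi> x z) (vector [u, t]) =
           vector [x' * cos (t * \<phi>), x' * sin (t * \<phi>), z']"
  by (rule pd_1_eqI[OF open_UNIV UNIV_I], rule helicoidal_i_vector)
     (auto intro!: derivative_eq_intros assms)

lemma pd_2_helicoidal_i:
  "pd 2 (helicoidal_i c \<phi> x z) (vector [u, t]) =
     vector [- \<phi> * x u * sin (t * \<phi>), \<phi> * x u * cos (t * \<phi>), c]"
  by (rule pd_2_eqI, rule helicoidal_i_vector)
     (auto intro!: derivative_eq_intros)

lemma pd_1_pd_1_helicoidal_i:
  assumes "open I" "u \<in> I"
    and "\<And>v. v \<in> I \<Longrightarrow> (x has_real_derivative x' v) (at v)"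
    and "\<And>v. v \<in> I \<Longrightarrow> (z has_real_derivative z' v) (at v)"
    and "(x' has_real_derivative x'') (at u)" "(z' has_real_derivative z'') (at u)"
  shows "pd 1 (pd 1 (helicoidal_i c \<phi> x z)) (vector [u, t]) =
           vector [x'' * cos (t * \<phi>), x'' * sin (t * \<phi>), z'']"
  by (rule pd_1_eqI[OF assms(1,2)], rule pd_1_helicoidal_i[OF assms(3,4)])
     (auto intro!: derivative_eq_intros assms(5,6))

lemma pd_1_pd_2_helicoidal_i:
  assumes "(x has_real_derivative x') (at u)"
  shows "pd 1 (pd 2 (helicoidal_i c \<phi> x z)) (vector [u, t]) =
           vector [- \<phi> * x' * sin (t * \<phi>), \<phi> * x' * cos (t * \<phi>), 0]"
  by (rule pd_1_eqI[OF open_UNIV UNIV_I], rule pd_2_helicoidal_i)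
     (auto intro!: derivative_eq_intros assms)

lemma pd_2_pd_2_helicoidal_i:
  "pd 2 (pd 2 (helicoidal_i c \<phi> x z)) (vector [u, t]) =
     vector [- \<phi>\<^sup>2 * x u * cos (t * \<phi>), - \<phi>\<^sup>2 * x u * sin (t * \<phi>), 0]"
  by (rule pd_2_eqI, rule pd_2_helicoidal_i)
     (auto intro!: derivative_eq_intros simp: power2_eq_square)

theorem proposition5p2:
  fixes c \<phi> :: real and x z :: "real \<Rightarrow> real" and I J :: "real set"
  assumes "open I" "is_interval I" "open J" "is_interval J"
    and "C2_differentiable_on (generating_curve x z) I"
    and "admissible_on (helicoidal_i c \<phi> x z) {p. p $ 1 \<in> I \<and> p $ 2 \<in> J}"
    and "u \<in> I" "t \<in> J"
  shows "gauss_curvature (helicoidal_i c \<phi> x z) (vector [u, t]) =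
           - (deriv z u * (deriv (deriv x) u * deriv z u - deriv x u * deriv (deriv z) u))
               / (x u * deriv x u ^ 4)
           - c\<^sup>2 / (\<phi>\<^sup>2 * x u ^ 4)
       \<and> mean_curvature (helicoidal_i c \<phi> x z) (vector [u, t]) =
           ((deriv x u)\<^sup>2 * deriv z u
              - x u * (deriv (deriv x) u * deriv z u - deriv x u * deriv (deriv z) u))
           / (2 * x u * deriv x u ^ 3)"
proof -
  let ?S = "helicoidal_i c \<phi> x z"
  let ?p = "vector [u, t] :: real^2"
  (* Opaque names turn the values at the point into atoms, so that what remains is rational
     algebra over the single relation CS. *)
  define X X1 X2 Z1 Z2 where "X = x u" and "X1 = deriv x u" and "X2 = deriv (deriv x) u"
    and "Z1 = deriv z u" and "Z2 = deriv (deriv z) u"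
  define C S where "C = cos (t * \<phi>)" and "S = sin (t * \<phi>)"
  note fold_defs = X_def[symmetric] X1_def[symmetric] X2_def[symmetric]
    Z1_def[symmetric] Z2_def[symmetric] C_def[symmetric] S_def[symmetric]
  have CS: "S * S = 1 - C * C"
    using sin_cos_squared_add[of "t * \<phi>"] by (simp add: C_def S_def power2_eq_square)
  note D = C2_generating_curve_imp_derivatives[OF assms(1,5)]
  have p1: "pd 1 ?S ?p = vector [X1 * C, X1 * S, Z1]"
    using pd_1_helicoidal_i[OF D(1,2)[OF assms(7)]] by (simp add: fold_defs)
  have p2: "pd 2 ?S ?p = vector [- \<phi> * X * S, \<phi> * X * C, c]"
    using pd_2_helicoidal_i by (simp add: fold_defs)
  have p11: "pd 1 (pd 1 ?S) ?p = vector [X2 * C, X2 * S, Z2]"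
    using pd_1_pd_1_helicoidal_i[OF assms(1,7) D(1,2) D(3,4)[OF assms(7)]]
    by (simp add: fold_defs)
  have p12: "pd 1 (pd 2 ?S) ?p = vector [- \<phi> * X1 * S, \<phi> * X1 * C, 0]"
    using pd_1_pd_2_helicoidal_i[OF D(1)[OF assms(7)]] by (simp add: fold_defs)
  have p22: "pd 2 (pd 2 ?S) ?p = vector [- \<phi>\<^sup>2 * X * C, - \<phi>\<^sup>2 * X * S, 0]"
    using pd_2_pd_2_helicoidal_i by (simp add: fold_defs)
  (* Wherever a sum of squares of C and S occurs it is displayed as a factor first: rewriting
     with CS then removes the dependence on the angle. *)
  have X12: "minor_X ?S 1 2 ?p = \<phi> * X * X1"
  proof -
    have "minor_X ?S 1 2 ?p = \<phi> * X * X1 * (C * C + S * S)"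
      by (simp add: minor_X_def p1 p2 algebra_simps)
    then show ?thesis by (simp add: CS)
  qed
  have "minor_X ?S 1 2 ?p \<noteq> 0"
    using assms(6-8) by (simp add: admissible_on_def)
  then have nz: "\<phi> \<noteq> 0" "X \<noteq> 0" "X1 \<noteq> 0"
    by (auto simp: X12)
  have g11: "first_form ?S 1 1 ?p = X1\<^sup>2"
  proof -
    have "first_form ?S 1 1 ?p = X1\<^sup>2 * (C * C + S * S)"
      by (simp add: first_form_def iso_metric_def p1 power2_eq_square algebra_simps)
    then show ?thesis by (simp add: CS)
  qed
  have g12: "first_form ?S 1 2 ?p = 0"
    by (simp add: first_form_def iso_metric_def p1 p2)
  have g22: "first_form ?S 2 2 ?p = \<phi>\<^sup>2 * X\<^sup>2"
  proof -
    have "first_form ?S 2 2 ?p = \<phi>\<^sup>2 * X\<^sup>2 * (C * C + S * S)"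
      by (simp add: first_form_def iso_metric_def p2 power2_eq_square algebra_simps)
    then show ?thesis by (simp add: CS)
  qed
  have N: "normal_h ?S ?p =
      vector [- (Z1 / X1) * C + c / (\<phi> * X) * S, - (Z1 / X1) * S - c / (\<phi> * X) * C, 1]"
    unfolding normal_h_def X12 using nz
    by (simp add: minor_X_def p1 p2 vec_eq_iff forall_3 field_simps)
  have h11: "second_form ?S 1 1 ?p = (X1 * Z2 - X2 * Z1) / X1"
  proof -
    have "second_form ?S 1 1 ?p = Z2 - Z1 / X1 * X2 * (C * C + S * S)"
      by (simp add: second_form_def N p11 inner_vec_def sum_3 algebra_simps)
    then show ?thesis using nz by (simp add: CS field_simps)
  qed
  have h12: "second_form ?S 1 2 ?p = - c * X1 / X"
  proof -
    have "second_form ?S 1 2 ?p = - (c / (\<phi> * X) * \<phi> * X1 * (C * C + S * S))"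
      by (simp add: second_form_def N p12 inner_vec_def sum_3 algebra_simps)
    then show ?thesis using nz by (simp add: CS)
  qed
  have h22: "second_form ?S 2 2 ?p = \<phi>\<^sup>2 * X * Z1 / X1"
  proof -
    have "second_form ?S 2 2 ?p = \<phi>\<^sup>2 * X * (Z1 / X1) * (C * C + S * S)"
      by (simp add: second_form_def N p22 inner_vec_def sum_3 algebra_simps add_divide_distrib)
    then show ?thesis by (simp add: CS)
  qed
  have "gauss_curvature ?S ?p = - (Z1 * (X2 * Z1 - X1 * Z2)) / (X * X1 ^ 4) - c\<^sup>2 / (\<phi>\<^sup>2 * X ^ 4)"
    unfolding gauss_curvature_def g11 g12 g22 h11 h12 h22 using nz
    by (simp add: field_simps power2_eq_square power4_eq_xxxx)
  moreover have "mean_curvature ?S ?p = (X1\<^sup>2 * Z1 - X * (X2 * Z1 - X1 * Z2)) / (2 * X * X1 ^ 3)"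
    unfolding mean_curvature_def g11 g12 g22 h11 h12 h22 using nz
    by (simp add: field_simps power2_eq_square power3_eq_cube)
  ultimately show ?thesis
    by (simp add: fold_defs)
qed

end
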